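(* Let $X_1,\dots,X_n$ be an i.i.d. sequence on a sublinear expectation space $(\Omega,\mathcal{H},\hat{\mathbb{E}})$ with $X_1\overset{d}{=}M_{[\underline{\mu},\overline{\mu}]}$, where $\underline{\mu}\le\overline{\mu}$ are unknown real parameters. Then the maximum likelihood estimator (MLE) of the parameters $\underline{\mu}$ and $\overline{\mu}$ is given by $$\hat{\underline{\mu}}=\min\{X_1,\dots,X_n\},\qquad \hat{\overline{\mu}}=\max\{X_1,\dots,X_n\}.$$ That is, for every realized sample $(x_1,\dots,x_n)\in\mathbb{R}^n$, the solution of the minimax problem $$\min_{\Delta}\max_{\underline{\mu},\overline{\mu}}V(x_1,\dots,x_n;\underline{\mu},\overline{\mu}),\qquad \Delta=\overline{\mu}-\underline{\mu},$$ is $(\underline{\mu},\overline{\mu})=(\min_{i}x_i,\max_{i}x_i)$.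
   Context: Sublinear expectation space: $\Omega$ is a Polish space and $\mathcal{H}$ is a linear space of real functions on $\Omega$ such that $X_1,\dots,X_n\in\mathcal{H}$ implies $\varphi(X_1,\dots,X_n)\in\mathcal{H}$ for every $n$ and every $\varphi\in C_{Lip}(\mathbb{R}^n)$, the space of all Lipschitz functions on $\mathbb{R}^n$. A sublinear expectation is a functional $\hat{\mathbb{E}}:\mathcal{H}\to\mathbb{R}$ such that for all $X,Y\in\mathcal{H}$: (1) $X\ge Y$ implies $\hat{\mathbb{E}}[X]\ge\hat{\mathbb{E}}[Y]$; (2) $\hat{\mathbb{E}}[c]=c$ for $c\in\mathbb{R}$; (3) $\hat{\mathbb{E}}[X+Y]\le\hat{\mathbb{E}}[X]+\hat{\mathbb{E}}[Y]$; (4) $\hat{\mathbb{E}}[\lambda X]=\lambda\hat{\mathbb{E}}[X]$ for $\lambda\ge0$. Identical distribution: $X\overset{d}{=}Y$ means $\hat{\mathbb{E}}[\varphi(X)]=\hat{\mathbb{E}}[\varphi(Y)]$ for all $\varphi\in C_{Lip}(\mathbb{R})$. Independence: $Y$ is independent of the random vector $X$ (of dimension $m$) if $\hat{\mathbb{E}}[\varphi(X,Y)]=\hat{\mathbb{E}}\big[\hat{\mathbb{E}}[\varphi(x,Y)]_{x=X}\big]$ for all $\varphi\in C_{Lip}(\mathbb{R}^{m+1})$. The sequence $X_1,\dots,X_n$ is i.i.d. if the $X_i$ are identically distributed and $X_{i+1}$ is independent of $(X_1,\dots,X_i)$ for each $1\le i<n$. Maximal distribution: $X\overset{d}{=}M_{[\underline{\mu},\overline{\mu}]}$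 means $\hat{\mathbb{E}}[\varphi(X)]=\max_{\underline{\mu}\le x\le\overline{\mu}}\varphi(x)$ for all $\varphi\in C_{Lip}(\mathbb{R})$. Likelihood function: $V(x_1,\dots,x_n;\underline{\mu},\overline{\mu}):=\hat{\mathbb{E}}[I_{\{X_1=x_1,\dots,X_n=x_n\}}]$ when the i.i.d. sequence has parameters $\underline{\mu}\le\overline{\mu}$. The indicator is not in $\mathcal{H}$, and its expectation is defined by Lipschitz approximation: $\hat{\mathbb{E}}[I_{\{X_1=x_1,\dots,X_n=x_n\}}]:=\lim_{k\to\infty}\hat{\mathbb{E}}\big[\prod_{i=1}^n\varphi_k^{x_i}(X_i)\big]$ with $\varphi_k^{x^*}(x)=\frac{1}{1+k|x-x^*|}$ (a decreasing limit). It depends only on $x_1,\dots,x_n,\underline{\mu},\overline{\mu}$. MLE / minimax problem: $\Delta=\overline{\mu}-\underline{\mu}$ is the degree of uncertainty of the maximal distribution. Solving $\min_\Delta\max_{\underline{\mu},\overline{\mu}}V$ means: among all pairs $\underline{\mu}\le\overline{\mu}$ that maximize $V(x_1,\dots,x_n;\cdot,\cdot)$, find the one with the smallest $\Delta$. This solution is the MLE of $(\underline{\mu},\overline{\mu})$. *)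

theory Defs
  imports "HOL-Analysis.Analysis"
begin

text \<open>
  A vector of \<open>\<real>\<^sup>n\<close> is represented by the values at \<open>0, \<dots>, n - 1\<close> of a function of type
  \<open>nat \<Rightarrow> real\<close>, because several dimensions occur in one definition. The
  Lipschitz bound (for the Euclidean distance) only involves these coordinates, so a
  function in \<open>C_Lip n\<close> cannot depend on the values at the other indices.
\<close>

definition C_Lip :: "nat \<Rightarrow> ((nat \<Rightarrow> real) \<Rightarrow> real) set" where
  "C_Lip n = {\<phi>. \<exists>L. \<forall>x y. \<bar>\<phi> x - \<phi> y\<bar> \<le> L * L2_set (\<lambda>i. x i - y i) {..<n}}"

definition C_Lip1 :: "(real \<Rightarrow> real) set" where
  "C_Lip1 = {\<phi>. \<exists>L. L-lipschitz_on UNIV \<phi>}"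

text \<open>
  The functional \<open>E\<close> is a total function in HOL; only its values on \<open>H\<close> are constrained.
\<close>

locale sublinear_expectation_space =
  fixes H :: "('a::polish_space \<Rightarrow> real) set"
    and E :: "('a \<Rightarrow> real) \<Rightarrow> real"
  assumes zero_mem: "(\<lambda>\<omega>. 0) \<in> H"
    and add_mem: "X \<in> H \<Longrightarrow> Y \<in> H \<Longrightarrow> (\<lambda>\<omega>. X \<omega> + Y \<omega>) \<in> H"
    and scale_mem: "X \<in> H \<Longrightarrow> (\<lambda>\<omega>. c * X \<omega>) \<in> H"
    and Lip_mem: "(\<And>i. i < n \<Longrightarrow> Z i \<in> H) \<Longrightarrow> \<phi> \<in> C_Lip n \<Longrightarrow> (\<lambda>\<omega>. \<phi> (\<lambda>i. Z i \<omega>)) \<in> H"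
    and mono: "X \<in> H \<Longrightarrow> Y \<in> H \<Longrightarrow> (\<And>\<omega>. Y \<omega> \<le> X \<omega>) \<Longrightarrow> E Y \<le> E X"
    and const: "E (\<lambda>\<omega>. c) = c"
    and subadd: "X \<in> H \<Longrightarrow> Y \<in> H \<Longrightarrow> E (\<lambda>\<omega>. X \<omega> + Y \<omega>) \<le> E X + E Y"
    and pos_homogeneous: "X \<in> H \<Longrightarrow> 0 \<le> l \<Longrightarrow> E (\<lambda>\<omega>. l * X \<omega>) = l * E X"

definition same_distr :: "(('a \<Rightarrow> real) \<Rightarrow> real) \<Rightarrow> ('a \<Rightarrow> real) \<Rightarrow> ('a \<Rightarrow> real) \<Rightarrow> bool" where
  "same_distr E X Y \<longleftrightarrow> (\<forall>\<phi>\<in>C_Lip1. E (\<lambda>\<omega>. \<phi> (X \<omega>)) = E (\<lambda>\<omega>. \<phi> (Y \<omega>)))"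

text \<open>
  \<open>indep_of E Y m X\<close>: \<open>Y\<close> is independent of the vector \<open>(X 0, \<dots>, X (m - 1))\<close>. The point of
  \<open>\<real>\<^sup>m\<^sup>+\<^sup>1\<close> with first \<open>m\<close> coordinates \<open>x\<close> and last coordinate \<open>y\<close> is \<open>x(m := y)\<close>.
\<close>

definition indep_of ::
    "(('a \<Rightarrow> real) \<Rightarrow> real) \<Rightarrow> ('a \<Rightarrow> real) \<Rightarrow> nat \<Rightarrow> (nat \<Rightarrow> 'a \<Rightarrow> real) \<Rightarrow> bool" where
  "indep_of E Y m X \<longleftrightarrow>
     (\<forall>\<phi>\<in>C_Lip (Suc m).
        E (\<lambda>\<omega>. \<phi> ((\<lambda>i. X i \<omega>)(m := Y \<omega>))) =
        E (\<lambda>\<omega>. (\<lambda>x. E (\<lambda>\<omega>'. \<phi> (x(m := Y \<omega>')))) (\<lambda>i. X i \<omega>)))"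

definition iid ::
    "('a \<Rightarrow> real) set \<Rightarrow> (('a \<Rightarrow> real) \<Rightarrow> real) \<Rightarrow> nat \<Rightarrow> (nat \<Rightarrow> 'a \<Rightarrow> real) \<Rightarrow> bool" where
  "iid H E n X \<longleftrightarrow>
     (\<forall>i<n. X i \<in> H) \<and>
     (\<forall>i<n. \<forall>j<n. same_distr E (X i) (X j)) \<and>
     (\<forall>i. 1 \<le> i \<and> i < n \<longrightarrow> indep_of E (X i) i X)"

text \<open>
  For \<open>a \<le> b\<close> the supremum is a maximum, since \<open>\<phi>\<close> is continuous and \<open>{a..b}\<close> is compact.
\<close>

definition maximal_distr :: "(('a \<Rightarrow> real) \<Rightarrow> real) \<Rightarrow> ('a \<Rightarrow> real) \<Rightarrow> real \<Rightarrow> real \<Rightarrow> bool" where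
  "maximal_distr E X a b \<longleftrightarrow> (\<forall>\<phi>\<in>C_Lip1. E (\<lambda>\<omega>. \<phi> (X \<omega>)) = (SUP x\<in>{a..b}. \<phi> x))"

definition bump :: "nat \<Rightarrow> real \<Rightarrow> real \<Rightarrow> real" where
  "bump k z x = 1 / (1 + real k * \<bar>x - z\<bar>)"

text \<open>
  The upper expectation of the indicator of \<open>{X 0 = x 0, \<dots>, X (n - 1) = x (n - 1)}\<close>. On a sublinear
  expectation space the sequence is decreasing and nonnegative, so the limit exists.
\<close>

definition likelihood ::
    "(('a \<Rightarrow> real) \<Rightarrow> real) \<Rightarrow> nat \<Rightarrow> (nat \<Rightarrow> 'a \<Rightarrow> real) \<Rightarrow> (nat \<Rightarrow> real) \<Rightarrow> real" where
  "likelihood E n X x = lim (\<lambda>k. E (\<lambda>\<omega>. \<Prod>i<n. bump k (x i) (X i \<omega>)))"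

text \<open>
  The pair \<open>(a, b)\<close> solves \<open>min\<^sub>\<Delta> max V\<close> for a likelihood \<open>V\<close> of the two parameters: it has the
  smallest \<open>\<Delta> = b - a\<close> among the admissible pairs maximizing \<open>V\<close>.
\<close>

definition is_MLE :: "(real \<Rightarrow> real \<Rightarrow> real) \<Rightarrow> real \<times> real \<Rightarrow> bool" where
  "is_MLE V p \<longleftrightarrow>
     is_arg_min (\<lambda>(a, b). b - a) (is_arg_max (\<lambda>(a, b). V a b) (\<lambda>(a, b). a \<le> b)) p"

end

theory Submission
  imports Defs
begin

text \<open>
  Independence and positive homogeneity factor the approximating expectations into
  \<open>\<Prod>i<n. SUP y\<in>{a..b}. bump k (x i) y\<close>. A factor equals \<open>1\<close> if \<open>x i\<close> lies in \<open>{a..b}\<close> and is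
  \<open>O(1/k)\<close> otherwise, so the likelihood is the indicator of \<open>x 0, \<dots>, x (n - 1) \<in> {a..b}\<close>. Its
  maximizers are the intervals containing the sample, and the shortest of them is
  \<open>{Min (x ` {..<n})..Max (x ` {..<n})}\<close>.
\<close>

lemma bump_nonneg: "0 \<le> bump k z x"
  by (simp add: bump_def)

lemma bump_le_1: "bump k z x \<le> 1"
  by (simp add: bump_def divide_le_eq_1 add_pos_nonneg)

lemma bump_self [simp]: "bump k z z = 1"
  by (simp add: bump_def)

text \<open>Both denominators are at least 1, so the reciprocals differ by no more than the
  denominators do.\<close>

lemma bump_diff_le: "\<bar>bump k z x - bump k z y\<bar> \<le> real k * \<bar>x - y\<bar>"
proof -
  define u v where "u = 1 + real k * \<bar>x - z\<bar>" and "v = 1 + real k * \<bar>y - z\<bar>"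
  have uv: "1 \<le> u" "1 \<le> v" "1 \<le> u * v"
    by (auto simp: u_def v_def intro: mult_ge1_I)
  have "\<bar>bump k z x - bump k z y\<bar> = \<bar>v - u\<bar> / (u * v)"
    using uv by (simp add: bump_def flip: u_def v_def) (simp add: field_simps abs_divide)
  also have "\<dots> \<le> \<bar>v - u\<bar> / 1"
    using uv by (intro divide_left_mono) auto
  also have "\<dots> = real k * \<bar>\<bar>y - z\<bar> - \<bar>x - z\<bar>\<bar>"
    by (simp add: u_def v_def abs_mult flip: right_diff_distrib)
  also have "\<dots> \<le> real k * \<bar>x - y\<bar>"
    by (intro mult_left_mono) auto
  finally show ?thesis .
qed

lemma bump_in_C_Lip1: "bump k z \<in> C_Lip1"
  unfolding C_Lip1_def
  by (auto intro!: exI[of _ "real k"] lipschitz_onI simp: dist_real_def bump_diff_le)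

text \<open>A product of factors in \<open>{0..1}\<close> changes by at most the sum of the changes
  of its factors, and each coordinate difference is bounded by the Euclidean distance. This is what
  lets \<open>Lip_mem\<close> and \<open>indep_of\<close> be applied to the product.\<close>

lemma prod_bump_in_C_Lip: "(\<lambda>z. \<Prod>i<m. bump k (x i) (z i)) \<in> C_Lip m"
proof -
  have "\<bar>(\<Prod>i<m. bump k (x i) (y i)) - (\<Prod>i<m. bump k (x i) (z i))\<bar>
      \<le> real m * real k * L2_set (\<lambda>i. y i - z i) {..<m}" for y z
  proof -
    have "\<bar>(\<Prod>i<m. bump k (x i) (y i)) - (\<Prod>i<m. bump k (x i) (z i))\<bar>
        \<le> (\<Sum>i<m. \<bar>bump k (x i) (y i) - bump k (x i) (z i)\<bar>)"
      using norm_prod_diff[of "{..<m}" "\<lambda>i. bump k (x i) (y i)" "\<lambda>i. bump k (x i) (z i)"]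
      by (simp add: bump_nonneg bump_le_1)
    also have "\<dots> \<le> (\<Sum>i<m. real k * L2_set (\<lambda>i. y i - z i) {..<m})"
    proof (rule sum_mono)
      fix i assume "i \<in> {..<m}"
      then have "\<bar>y i - z i\<bar> \<le> L2_set (\<lambda>i. \<bar>y i - z i\<bar>) {..<m}"
        by (intro member_le_L2_set) auto
      then have "\<bar>y i - z i\<bar> \<le> L2_set (\<lambda>i. y i - z i) {..<m}"
        by (simp add: L2_set_def)
      then show "\<bar>bump k (x i) (y i) - bump k (x i) (z i)\<bar>
          \<le> real k * L2_set (\<lambda>i. y i - z i) {..<m}"
        by (intro order_trans[OF bump_diff_le] mult_left_mono) auto
    qed
    finally show ?thesis by simp
  qed
  then show ?thesis unfolding C_Lip_def by blast
qed

lemma (in sublinear_expectation_space) prod_bump_mem: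
  fixes m :: nat
  assumes "\<And>i. i < m \<Longrightarrow> X i \<in> H"
  shows "(\<lambda>\<omega>. \<Prod>i<m. bump k (x i) (X i \<omega>)) \<in> H"
  using Lip_mem[of m X, OF assms prod_bump_in_C_Lip] .

lemma (in sublinear_expectation_space) bump_mem:
  assumes "Y \<in> H"
  shows "(\<lambda>\<omega>. bump k z (Y \<omega>)) \<in> H"
  using prod_bump_mem[of "Suc 0" "\<lambda>_. Y" k "\<lambda>_. z"] assms by simp

text \<open>Independence splits off the last factor. Only positive homogeneity is available to pull
  factors out, so their nonnegativity is essential. The induction runs over prefixes of the fixed
  sequence of length \<open>n\<close>.\<close>

lemma (in sublinear_expectation_space) E_prod_bump:
  assumes iid: "iid H E n X" and "m \<le> n"
  shows "E (\<lambda>\<omega>. \<Prod>i<m. bump k (x i) (X i \<omega>)) = (\<Prod>i<m. E (\<lambda>\<omega>. bump k (x i) (X i \<omega>)))"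
  using \<open>m \<le> n\<close>
proof (induction m)
  case 0
  show ?case by (simp add: const)
next
  case (Suc m)
  have H: "X i \<in> H" if "i \<le> m" for i
    using that Suc.prems iid by (simp add: iid_def)
  let ?s = "E (\<lambda>\<omega>. bump k (x m) (X m \<omega>))"
  have "E (\<lambda>\<omega>. 0) \<le> ?s"
    by (intro mono bump_mem zero_mem H) (auto simp: bump_nonneg)
  then have s: "0 \<le> ?s" by (simp add: const)
  show ?case
  \<comment> \<open>Independence is only given from index 1 on; for a single factor the claim is
    trivial.\<close>
  proof (cases "m = 0")
    case True
    then show ?thesis by simp
  next
    case False
    then have "indep_of E (X m) m X"
      using Suc.prems iid by (simp add: iid_def)
    from this[unfolded indep_of_def, rule_format, OF prod_bump_in_C_Lip[of k x "Suc m"]]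
    have "E (\<lambda>\<omega>. \<Prod>i<Suc m. bump k (x i) (X i \<omega>))
        = E (\<lambda>\<omega>. E (\<lambda>\<omega>'. (\<Prod>i<m. bump k (x i) (X i \<omega>)) * bump k (x m) (X m \<omega>')))"
      by simp
    \<comment> \<open>For fixed \<open>\<omega>\<close> the product is a nonnegative constant inside
      the inner expectation.\<close>
    also have "\<dots> = E (\<lambda>\<omega>. ?s * (\<Prod>i<m. bump k (x i) (X i \<omega>)))"
      by (subst pos_homogeneous) (simp_all add: bump_mem H prod_nonneg bump_nonneg mult.commute)
    also have "\<dots> = ?s * E (\<lambda>\<omega>. \<Prod>i<m. bump k (x i) (X i \<omega>))"
      using s by (intro pos_homogeneous prod_bump_mem H) auto
    finally show ?thesis
      using Suc by (simp add: mult.commute)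
  qed
qed

lemma bdd_above_bump: "bdd_above (bump k z ` A)"
  using bump_le_1 by (auto intro!: bdd_aboveI[of _ 1])

lemma SUP_bump_nonneg:
  assumes "a \<le> b"
  shows "0 \<le> (SUP y\<in>{a..b}. bump k z y)"
  using assms by (intro cSUP_upper2[OF bdd_above_bump, of a]) (auto simp: bump_nonneg)

lemma SUP_bump_le_1:
  assumes "a \<le> b"
  shows "(SUP y\<in>{a..b}. bump k z y) \<le> 1"
  using assms by (intro cSUP_least) (auto simp: bump_le_1)

lemma SUP_bump_mem:
  assumes "z \<in> {a..b}"
  shows "(SUP y\<in>{a..b}. bump k z y) = 1"
proof (rule antisym)
  show "(SUP y\<in>{a..b}. bump k z y) \<le> 1"
    using assms by (intro SUP_bump_le_1) auto
  show "1 \<le> (SUP y\<in>{a..b}. bump k z y)"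
    using assms by (intro cSUP_upper2[OF bdd_above_bump, of z]) auto
qed

lemma SUP_bump_tendsto_0:
  assumes "a \<le> b" and "z \<notin> {a..b}"
  shows "(\<lambda>k. SUP y\<in>{a..b}. bump k z y) \<longlonglongrightarrow> 0"
proof -
  \<comment> \<open>The distance from \<open>z\<close> to the interval \<open>{a..b}\<close>,
    positive because \<open>z\<close> lies outside.\<close>
  define d where "d = max (a - z) (z - b)"
  have d: "0 < d" using assms by (auto simp: d_def)
  have le: "(SUP y\<in>{a..b}. bump k z y) \<le> 1 / (1 + real k * d)" for k
  proof (rule cSUP_least)
    show "{a..b} \<noteq> {}" using assms by auto
    fix y assume "y \<in> {a..b}"
    then have "d \<le> \<bar>y - z\<bar>" by (auto simp: d_def)
    then show "bump k z y \<le> 1 / (1 + real k * d)"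
      unfolding bump_def using d
      by (intro divide_left_mono add_left_mono mult_left_mono mult_pos_pos) (auto intro: add_pos_nonneg)
  qed
  have "filterlim (\<lambda>k. 1 + real k * d) at_top sequentially"
    using d by (intro filterlim_tendsto_add_at_top[OF tendsto_const]
      filterlim_at_top_mult_tendsto_pos[OF tendsto_const] filterlim_real_sequentially) auto
  then have "(\<lambda>k. 1 / (1 + real k * d)) \<longlonglongrightarrow> 0"
    by (rule real_tendsto_divide_at_top[OF tendsto_const])
  then show ?thesis
    by (rule tendsto_sandwich[OF _ _ tendsto_const, rotated 2])
      (auto simp: le SUP_bump_nonneg[OF \<open>a \<le> b\<close>])
qed

lemma likelihood_maximal_distr:
  assumes "a \<le> b" and space: "sublinear_expectation_space H E"
    and iid: "iid H E n X" and distr: "maximal_distr E (X 0) a b"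
  shows "likelihood E n X x = of_bool (x ` {..<n} \<subseteq> {a..b})"
proof -
  interpret sublinear_expectation_space H E by (rule space)
  let ?S = "\<lambda>k i. SUP y\<in>{a..b}. bump k (x i) y"
  have marginal: "E (\<lambda>\<omega>. bump k (x i) (X i \<omega>)) = ?S k i" if "i < n" for k i
  proof -
    have "same_distr E (X i) (X 0)"
      using iid that by (auto simp: iid_def)
    then show ?thesis
      using distr bump_in_C_Lip1 by (auto simp: same_distr_def maximal_distr_def)
  qed
  have eq: "E (\<lambda>\<omega>. \<Prod>i<n. bump k (x i) (X i \<omega>)) = (\<Prod>i<n. ?S k i)" for k
    using E_prod_bump[OF iid order_refl] marginal by simp
  have "(\<lambda>k. \<Prod>i<n. ?S k i) \<longlonglongrightarrow> of_bool (x ` {..<n} \<subseteq> {a..b})"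
  proof (cases "x ` {..<n} \<subseteq> {a..b}")
    case True
    then have "(\<Prod>i<n. ?S k i) = 1" for k
      by (intro prod.neutral) (auto intro!: SUP_bump_mem)
    with True show ?thesis by simp
  next
    case False
    then obtain j where j: "j < n" "x j \<notin> {a..b}" by blast
    \<comment> \<open>All other factors lie in \<open>{0..1}\<close>, so one vanishing factor forces
      the limit 0.\<close>
    have "(\<Prod>i<n. ?S k i) \<le> ?S k j" for k
    proof -
      have "(\<Prod>i<n. ?S k i) = ?S k j * (\<Prod>i\<in>{..<n} - {j}. ?S k i)"
        using j by (intro prod.remove) auto
      also have "\<dots> \<le> ?S k j * 1"
        using \<open>a \<le> b\<close>
        by (intro mult_left_mono prod_le_1) (auto simp: SUP_bump_nonneg SUP_bump_le_1)
      finally show ?thesis by simp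
    qed
    then have "(\<lambda>k. \<Prod>i<n. ?S k i) \<longlonglongrightarrow> 0"
      by (intro tendsto_sandwich[OF _ _ tendsto_const SUP_bump_tendsto_0[OF \<open>a \<le> b\<close> j(2)]])
        (auto simp: prod_nonneg SUP_bump_nonneg[OF \<open>a \<le> b\<close>])
    with False show ?thesis by simp
  qed
  then show ?thesis
    unfolding likelihood_def eq by (rule limI)
qed

text \<open>\<open>V\<close> is prescribed only for \<open>a \<le> b\<close> because only such pairs
  compete. The value 1 is attained at \<open>(Min S, Max S)\<close>, so the maximizers are the
  intervals containing \<open>S\<close>.\<close>

lemma is_MLE_of_bool_subset_interval:
  assumes S: "finite S" "S \<noteq> {}"
    and V: "\<And>a b. a \<le> b \<Longrightarrow> V a b = of_bool (S \<subseteq> {a..b})"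
  shows "is_MLE V p \<longleftrightarrow> p = (Min S, Max S)"
proof -
  have S_sub: "S \<subseteq> {a..b} \<longleftrightarrow> a \<le> Min S \<and> Max S \<le> b" for a b
    using S by auto
  have le: "Min S \<le> Max S"
    using S by simp
  have max: "is_arg_max (\<lambda>(a, b). V a b) (\<lambda>(a, b). a \<le> b) (a, b)
      \<longleftrightarrow> a \<le> Min S \<and> Max S \<le> b" for a b
  proof
    assume "is_arg_max (\<lambda>(a, b). V a b) (\<lambda>(a, b). a \<le> b) (a, b)"
    then have "a \<le> b" "\<not> V a b < V (Min S) (Max S)"
      using le by (auto simp: is_arg_max_def)
    then show "a \<le> Min S \<and> Max S \<le> b"
      using le by (auto simp: V S_sub split: if_splits)
  next
    assume "a \<le> Min S \<and> Max S \<le> b"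
    then show "is_arg_max (\<lambda>(a, b). V a b) (\<lambda>(a, b). a \<le> b) (a, b)"
      using le by (auto simp: is_arg_max_def V S_sub)
  qed
  show ?thesis
  proof (cases p)
    case (Pair a b)
    show ?thesis
    proof
      assume "is_MLE V p"
      \<comment> \<open>The pair \<open>(Min S, Max S)\<close> serves as competitor: an interval
        that contains \<open>S\<close> and is no longer than it must coincide with it.\<close>
      then have "a \<le> Min S" "Max S \<le> b" "\<not> Max S - Min S < b - a"
        unfolding Pair is_MLE_def is_arg_min_def by (force simp: max)+
      then show "p = (Min S, Max S)"
        by (simp add: Pair)
    next
      assume "p = (Min S, Max S)"
      then show "is_MLE V p"
        by (force simp: is_MLE_def is_arg_min_def max)
    qed
  qed
qed

text \<open>Each parameter pair may have its own space, expectation and sequence, since the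
  likelihood compares different models. The equivalence gives both existence and uniqueness of the
  solution.\<close>

theorem theorem3p4:
  fixes n :: nat
    and H :: "real \<Rightarrow> real \<Rightarrow> ('a::polish_space \<Rightarrow> real) set"
    and E :: "real \<Rightarrow> real \<Rightarrow> ('a \<Rightarrow> real) \<Rightarrow> real"
    and X :: "real \<Rightarrow> real \<Rightarrow> nat \<Rightarrow> 'a \<Rightarrow> real"
  assumes n: "1 \<le> n"
    and space: "\<And>a b. a \<le> b \<Longrightarrow> sublinear_expectation_space (H a b) (E a b)"
    and iid: "\<And>a b. a \<le> b \<Longrightarrow> iid (H a b) (E a b) n (X a b)"
    and distr: "\<And>a b. a \<le> b \<Longrightarrow> maximal_distr (E a b) (X a b 0) a b"
  shows "\<forall>x :: nat \<Rightarrow> real. \<forall>p.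
           is_MLE (\<lambda>a b. likelihood (E a b) n (X a b) x) p
             \<longleftrightarrow> p = (Min (x ` {..<n}), Max (x ` {..<n}))"
proof (intro allI)
  fix x :: "nat \<Rightarrow> real" and p
  show "is_MLE (\<lambda>a b. likelihood (E a b) n (X a b) x) p
      \<longleftrightarrow> p = (Min (x ` {..<n}), Max (x ` {..<n}))"
    using n by (intro is_MLE_of_bool_subset_interval likelihood_maximal_distr[OF _ space iid distr])
      (auto simp: lessThan_empty_iff)
qed

end
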